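(* For every complex $q$ with $|q|<1$, $$\sum_{n,l=0}^\infty\frac{q^{n^2+l^2+n+l+nl}}{(q^2;q)_{n+l}(q;q)_n(q;q)_l}=\frac{1}{(q^2;q)_\infty}\prod_{\substack{m\ge1\\ m\not\equiv0,\pm1\ (\mathrm{mod}\ 5)}}\frac{1}{1-q^m}.$$
   Context: Notation: $(x;q)_n=\prod_{j=0}^{n-1}(1-xq^j)$ for integers $n\ge0$, and $(x;q)_\infty=\prod_{j\ge0}(1-xq^j)$. *)

theory Defs
  imports "HOL-Analysis.Analysis" "HOL-Number_Theory.Number_Theory"
begin

definition qpoch :: "complex \<Rightarrow> complex \<Rightarrow> nat \<Rightarrow> complex" where
  "qpoch x q n = (\<Prod>j<n. 1 - x * q ^ j)"

definition qpoch_inf :: "complex \<Rightarrow> complex \<Rightarrow> complex" where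
  "qpoch_inf x q = (\<Prod>j. 1 - x * q ^ j)"

text \<open>For \<open>norm q < 1\<close> the infinite products below converge, so \<open>prodinf\<close> takes no junk value.\<close>

lemma convergent_prod_qpoch_inf:
  assumes "norm q < 1"
  shows "convergent_prod (\<lambda>j. 1 - x * q ^ j :: complex)"
proof -
  have "summable (\<lambda>j. norm x * norm q ^ j)"
    using assms by (intro summable_mult summable_geometric) simp
  then have "summable (\<lambda>j. norm (1 - x * q ^ j - 1))"
    by (simp add: norm_mult norm_power)
  then have "abs_convergent_prod (\<lambda>j. 1 - x * q ^ j)"
    by (rule summable_imp_abs_convergent_prod)
  then show ?thesis
    by (rule abs_convergent_prod_imp_convergent_prod)
qed

lemma convergent_prod_residues:
  assumes "norm q < 1"
  shows "convergent_prod (\<lambda>m. if P m then 1 / (1 - q ^ m) else 1 :: complex)"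
proof -
  have "summable (\<lambda>m. norm q ^ m)"
    using assms by (intro summable_geometric) simp
  then have "summable (\<lambda>m. norm ((if P m then 1 - q ^ m else 1) - 1))"
    by (rule summable_comparison_test'[where N = 0]) (auto simp: norm_power)
  then have "convergent_prod (\<lambda>m. if P m then 1 - q ^ m else 1)"
    by (intro abs_convergent_prod_imp_convergent_prod summable_imp_abs_convergent_prod)
  then have "convergent_prod (\<lambda>m. inverse (if P m then 1 - q ^ m else 1))"
    by (rule convergent_prod_inverse)
  moreover have "(\<lambda>m. inverse (if P m then 1 - q ^ m else 1)) =
      (\<lambda>m. if P m then 1 / (1 - q ^ m) else 1)"
    by (auto simp: divide_inverse)
  ultimately show ?thesis
    by simp
qed

end

(*
Write P n for (q;q)_n.  Since (q^2;q)_n = P (n + 1) / (1 - q), summing over l first is an instance of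
the Durfee rectangle identity

  sum_l q^(l(l+a)) / (P l P (l+a)) = 1 / (q;q)_inf

with a = n + 1, and what remains is (1 - q) / (q;q)_inf times the sum side of the second
Rogers-Ramanujan identity, sum_n q^(n^2+n) / P n.  In the latter, 1 / P n is expanded by a Bailey
pair; after interchanging the sums, the Durfee rectangle identity with a = 2r + 1 evaluates the
sum over n, leaving a theta series to which the Jacobi triple product applies.  The Durfee and
triple product identities are obtained from finite versions by Tannery's theorem.
*)

theory Submission imports Defs begin

section \<open>Finite q-Pochhammer symbols\<close>

lemma qpoch_0 [simp]: "qpoch x q 0 = 1"
  by (simp add: qpoch_def)

lemma qpoch_Suc: "qpoch x q (Suc n) = qpoch x q n * (1 - x * q ^ n)"
  by (simp add: qpoch_def)

lemma qpoch_Suc_shift: "qpoch x q (Suc n) = (1 - x) * qpoch (x * q) q n"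
  by (simp add: qpoch_def prod.lessThan_Suc_shift mult.assoc del: prod.lessThan_Suc)

lemma one_minus_power_nonzero:
  fixes q :: "'a :: real_normed_div_algebra"
  assumes "norm q < 1"
  shows "1 - q ^ Suc n \<noteq> 0"
proof -
  have "norm (q ^ Suc n) < 1"
    unfolding norm_power using assms power_Suc_less_one[of "norm q" n] by (cases "q = 0") auto
  then show ?thesis
    by auto
qed

lemma qpoch_nonzero:
  assumes "norm q < 1"
  shows "qpoch q q n \<noteq> 0"
  using one_minus_power_nonzero[OF assms] by (simp add: qpoch_def)

section \<open>Gaussian binomial coefficients\<close>

text \<open>The q-Pascal rule serves as definition, rather than the quotient of q-factorials, so
  that no denominator has to be nonzero and the finite product expansions hold for all complex
  arguments.\<close>

fun qbin :: "complex \<Rightarrow> nat \<Rightarrow> nat \<Rightarrow> complex" where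
  "qbin q n 0 = 1"
| "qbin q 0 (Suc k) = 0"
| "qbin q (Suc n) (Suc k) = qbin q n k + q ^ Suc k * qbin q n (Suc k)"

lemma qbin_eq_0: "n < k \<Longrightarrow> qbin q n k = 0"
  by (induction q n k rule: qbin.induct) auto

text \<open>The factorial formula without division. Writing j = i + 1, Pascal's rule contributes the
  factors \<open>1 - q ^ Suc i\<close> and \<open>q ^ Suc i * (1 - q ^ k)\<close>, which add up to
  \<open>1 - q ^ (j + k)\<close>.\<close>

lemma qbin_mult_qpoch: "qbin q (j + k) j * (qpoch q q j * qpoch q q k) = qpoch q q (j + k)"
proof (induction "j + k" arbitrary: j k)
  case (Suc n)
  show ?case
  proof (cases j)
    case (Suc i)
    have A: "qbin q (i + k) i * (qpoch q q i * qpoch q q k) = qpoch q q (i + k)"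
      using Suc.hyps(1)[of i k] Suc Suc.hyps(2) by simp
    have B: "qbin q (i + k) (Suc i) * (qpoch q q j * qpoch q q k) =
        qpoch q q (i + k) * (1 - q ^ k)"
    proof (cases k)
      case (Suc k')
      have "i + k = j + k'"
        using Suc \<open>j = Suc i\<close> by simp
      then have "qbin q (i + k) j * (qpoch q q j * qpoch q q k') = qpoch q q (i + k)"
        using Suc.hyps(1)[of j k'] Suc.hyps(2) \<open>j = Suc i\<close> by simp
      then show ?thesis
        using \<open>j = Suc i\<close> by (simp only: Suc qpoch_Suc mult.assoc power_Suc flip: mult.assoc)
    qed (simp add: qbin_eq_0)
    have "qbin q (j + k) j * (qpoch q q j * qpoch q q k) =
        (qbin q (i + k) i * (qpoch q q i * qpoch q q k)) * (1 - q ^ Suc i) +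
        q ^ Suc i * (qbin q (i + k) (Suc i) * (qpoch q q j * qpoch q q k))"
      using Suc by (simp add: qpoch_Suc algebra_simps)
    also have "\<dots> = qpoch q q (j + k)"
      unfolding A B using Suc by (simp add: qpoch_Suc power_add algebra_simps)
    finally show ?thesis .
  qed simp
qed simp

lemma qbin_eq:
  assumes "norm q < 1" "k \<le> n"
  shows "qbin q n k = qpoch q q n / (qpoch q q k * qpoch q q (n - k))"
  using qbin_mult_qpoch[of q k "n - k"] assms qpoch_nonzero[OF assms(1)]
  by (simp add: field_simps)

text \<open>Pascal's rule applied under a weighted sum; it drives the inductions for the finite
  Durfee identity, the q-binomial theorem and the finite triple product.\<close>

lemma sum_qbin_Suc:
  "(\<Sum>j\<le>Suc n. qbin q (Suc n) j * f j) =
     (\<Sum>j\<le>n. qbin q n j * f (Suc j)) + (\<Sum>j\<le>n. q ^ j * qbin q n j * f j)"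
proof -
  have "(\<Sum>j\<le>Suc n. qbin q (Suc n) j * f j) =
      (\<Sum>j\<le>n. qbin q n j * f (Suc j)) +
      (f 0 + (\<Sum>j\<le>n. q ^ Suc j * qbin q n (Suc j) * f (Suc j)))"
    by (simp add: sum.atMost_Suc_shift sum.distrib algebra_simps del: sum.atMost_Suc)
  \<comment> \<open>The lone \<open>f 0\<close> is the term j = 0 of the second sum, and the term j
    = n + 1 vanishes.\<close>
  also have "f 0 + (\<Sum>j\<le>n. q ^ Suc j * qbin q n (Suc j) * f (Suc j)) =
      (\<Sum>j\<le>Suc n. q ^ j * qbin q n j * f j)"
    by (simp add: sum.atMost_Suc_shift del: sum.atMost_Suc)
  also have "\<dots> = (\<Sum>j\<le>n. q ^ j * qbin q n j * f j)"
    by (simp add: qbin_eq_0)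
  finally show ?thesis .
qed

section \<open>The finite Durfee rectangle identity and the q-binomial theorem\<close>

text \<open>A case of the q-Chu-Vandermonde sum. Pascal's rule carries the sum for (n + 1, a) to the
  one for (n, a + 1), which has the same right-hand side; hence the induction leaves
  \<open>a\<close> free.\<close>

lemma durfee_rectangle_finite:
  assumes "norm q < 1"
  shows "(\<Sum>l\<le>n. qbin q n l * (q ^ (l * (l + a)) / qpoch q q (l + a))) = 1 / qpoch q q (n + a)"
proof (induction n arbitrary: a)
  case (Suc n)
  \<comment> \<open>The subtracted term is exactly the first sum produced by
    \<open>sum_qbin_Suc\<close>, so the two cancel.\<close>
  have *: "q ^ l * qbin q n l * (q ^ (l * (l + a)) / qpoch q q (l + a)) =
      qbin q n l * (q ^ (l * (l + Suc a)) / qpoch q q (l + Suc a))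
      - qbin q n l * (q ^ (Suc l * (Suc l + a)) / qpoch q q (Suc l + a))" for l
  proof -
    have "q ^ (l * (l + Suc a)) = q ^ l * q ^ (l * (l + a))"
      by (simp flip: power_add add: algebra_simps)
    moreover have "q ^ (Suc l * (Suc l + a)) = q ^ Suc (l + a) * (q ^ l * q ^ (l * (l + a)))"
      unfolding power_add[symmetric] by (rule arg_cong[where f = "power q"]) (simp add: algebra_simps)
    ultimately show ?thesis
      using qpoch_nonzero[OF assms, of "l + a"] one_minus_power_nonzero[OF assms, of "l + a"]
      by (simp add: qpoch_Suc divide_simps) (auto simp: algebra_simps)
  qed
  have "(\<Sum>l\<le>Suc n. qbin q (Suc n) l * (q ^ (l * (l + a)) / qpoch q q (l + a))) =
      (\<Sum>l\<le>n. qbin q n l * (q ^ (l * (l + Suc a)) / qpoch q q (l + Suc a)))"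
    unfolding sum_qbin_Suc * sum_subtractf by simp
  also have "\<dots> = 1 / qpoch q q (Suc n + a)"
    unfolding Suc.IH by simp
  finally show ?case .
qed simp

text \<open>Splitting off the factor j = 0 replaces y by y q in the rest. Multiplying the expansion
  by 1 - y then gives the two sums of \<open>sum_qbin_Suc\<close>: the part with -y raises the
  index, the other keeps it.\<close>

lemma q_binomial_theorem:
  "(\<Prod>j<n. 1 - y * q ^ j) = (\<Sum>j\<le>n. qbin q n j * ((- y) ^ j * q ^ (j * (j - 1) div 2)))"
proof (induction n arbitrary: y)
  case (Suc n)
  have T: "Suc j * j div 2 = j * (j - 1) div 2 + j" for j :: nat
    by (cases j) auto
  have M: "(- (y * q)) ^ j = (- y) ^ j * q ^ j" for j
    by (metis mult_minus_left power_mult_distrib)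
  have "(\<Prod>j<Suc n. 1 - y * q ^ j) = (1 - y) * (\<Prod>j<n. 1 - (y * q) * q ^ j)"
    by (simp only: prod.lessThan_Suc_shift o_def) (simp add: mult.assoc)
  also have "\<dots> = (\<Sum>j\<le>Suc n. qbin q (Suc n) j * ((- y) ^ j * q ^ (j * (j - 1) div 2)))"
    unfolding Suc.IH sum_qbin_Suc sum_distrib_left sum.distrib[symmetric]
  proof (rule sum.cong)
    fix j
    show "(1 - y) * (qbin q n j * ((- (y * q)) ^ j * q ^ (j * (j - 1) div 2))) =
        qbin q n j * ((- y) ^ Suc j * q ^ (Suc j * (Suc j - 1) div 2)) +
        q ^ j * qbin q n j * ((- y) ^ j * q ^ (j * (j - 1) div 2))"
      unfolding diff_Suc_1 T M power_add power_Suc by (simp add: algebra_simps)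
  qed simp
  finally show ?case .
qed simp

section \<open>A Bailey pair for the second Rogers-Ramanujan identity\<close>

text \<open>The right-hand side is a Wilf-Zeilberger certificate; it vanishes at \<open>s = 0\<close> and
  cancels the remaining boundary term at \<open>s = n + 1\<close>.\<close>

lemma bailey_pair_telescope:
  fixes q :: complex
  defines "f \<equiv> \<lambda>n r. (-1) ^ r * q ^ (r * (3 * r + 1) div 2) * (1 - q ^ (2 * r + 1)) /
                      (qpoch q q (n - r) * qpoch q q (n + r + 1))"
  assumes "norm q < 1" "s \<le> Suc n"
  shows "(\<Sum>r<s. qpoch q q (Suc n) * f (Suc n) r - qpoch q q n * f n r) =
           - ((-1) ^ s * q ^ (Suc n + s * (3 * s - 1) div 2) * (1 - q ^ s) * qpoch q q n /
              (qpoch q q (Suc n - s) * qpoch q q (Suc n + s)))"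
  using assms(3)
proof (induction s)
  case (Suc s)
  define k where "k = n - s"
  have n: "n = k + s"
    using Suc.prems by (simp add: k_def)
  \<comment> \<open>Every power of q in the step becomes a monomial in \<open>q\<close>,
    \<open>u\<close>, \<open>v\<close> and \<open>d\<close>, so that the step reduces to an identity
    of rational functions, settled by clearing denominators.\<close>
  define u v where "u = q ^ k" and "v = q ^ s"
  define d where "d = q ^ (s * (3 * s - 1) div 2)"
  have "s * (3 * s + 1) div 2 = s * (3 * s - 1) div 2 + s"
    by (cases s) (auto simp: algebra_simps)
  then have c: "q ^ (s * (3 * s + 1) div 2) = d * v"
    by (simp add: d_def v_def power_add)
  have "Suc s * (3 * Suc s - 1) div 2 = s * (3 * s - 1) div 2 + s + s + s + 1"
    by (cases s) (auto simp: algebra_simps)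
  then have c': "q ^ (Suc s * (3 * Suc s - 1) div 2) = d * v * v * v * q"
    by (simp add: d_def v_def power_add)
  have nz: "qpoch q q n \<noteq> 0" "qpoch q q k \<noteq> 0" "qpoch q q (Suc n + s) \<noteq> 0"
      "1 - q * u \<noteq> 0" "1 - q * (q * (u * v * v)) \<noteq> 0"
    using qpoch_nonzero[OF assms(2)] one_minus_power_nonzero[OF assms(2), of k]
      one_minus_power_nonzero[OF assms(2), of "Suc n + s"]
    by (simp_all add: u_def v_def n power_add mult_ac)
  have P: "qpoch q q (Suc n) = qpoch q q n * (1 - q * (u * v))"
      "qpoch q q (Suc n - s) = qpoch q q k * (1 - q * u)"
      "qpoch q q (Suc n + s + 1) = qpoch q q (Suc n + s) * (1 - q * (q * (u * v * v)))"
    by (simp_all add: qpoch_Suc u_def v_def n power_add mult_ac Suc_diff_le)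
  have "(\<Sum>r<Suc s. qpoch q q (Suc n) * f (Suc n) r - qpoch q q n * f n r) =
      - ((-1) ^ s * (q * (u * v) * d) * (1 - v) * qpoch q q n /
              (qpoch q q k * (1 - q * u) * qpoch q q (Suc n + s))) +
      (qpoch q q n * (1 - q * (u * v)) * ((-1) ^ s * (d * v) * (1 - q * v * v) /
        (qpoch q q k * (1 - q * u) * (qpoch q q (Suc n + s) * (1 - q * (q * (u * v * v)))))) -
      qpoch q q n * ((-1) ^ s * (d * v) * (1 - q * v * v) / (qpoch q q k * qpoch q q (Suc n + s))))"
  proof -
    have "q ^ (Suc n + s * (3 * s - 1) div 2) = q * (u * v) * d"
      by (simp add: u_def v_def d_def n power_add)
    moreover have "q ^ (2 * s + 1) = q * v * v"
      by (simp add: v_def mult_2 power_add)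
    moreover have "q ^ s = v"
      by (simp add: v_def)
    moreover have "n + s + 1 = Suc n + s" "n - s = k"
      using n by auto
    ultimately show ?thesis
      unfolding sum.lessThan_Suc Suc.IH[OF Suc_leD[OF Suc.prems]] unfolding f_def
      by (simp only: P c)
  qed
  also have "\<dots> = (-1) ^ s * (q * (u * v) * (d * v * v * v * q)) * (1 - q * v) * qpoch q q n /
              (qpoch q q k * (qpoch q q (Suc n + s) * (1 - q * (q * (u * v * v)))))"
    using nz by (simp add: divide_simps) (simp add: algebra_simps)
  also have "\<dots> = - ((-1) ^ Suc s * q ^ (Suc n + Suc s * (3 * Suc s - 1) div 2) * (1 - q ^ Suc s) * qpoch q q n /
              (qpoch q q (Suc n - Suc s) * qpoch q q (Suc n + Suc s)))"
    unfolding power_add c' using P(3) by (simp add: u_def v_def n power_add)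
  finally show ?case .
qed simp

text \<open>In Bailey's terms: a pair relative to \<open>a = q\<close> with \<open>\<beta>\<^sub>n = 1 / (q; q)\<^sub>n\<close>.\<close>

lemma bailey_pair:
  fixes q :: complex
  assumes "norm q < 1"
  shows "(\<Sum>r\<le>n. (-1) ^ r * q ^ (r * (3 * r + 1) div 2) * (1 - q ^ (2 * r + 1)) /
                (qpoch q q (n - r) * qpoch q q (n + r + 1))) = 1 / qpoch q q n"
proof -
  define f where "f = (\<lambda>n r. (-1) ^ r * q ^ (r * (3 * r + 1) div 2) * (1 - q ^ (2 * r + 1)) /
                      (qpoch q q (n - r) * qpoch q q (n + r + 1)))"
  \<comment> \<open>Multiplied by \<open>qpoch q q n\<close>, the sum is constant in n, so it
    suffices that consecutive sums agree.\<close>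
  have "(\<Sum>r\<le>n. qpoch q q n * f n r) = 1"
  proof (induction n)
    case 0
    show ?case
      using one_minus_power_nonzero[OF assms, of 0] by (simp add: f_def qpoch_Suc)
  next
    case (Suc n)
    let ?N = "Suc n"
    have "?N * (3 * ?N + 1) div 2 = ?N + ?N * (3 * ?N - 1) div 2"
      by (auto simp: algebra_simps)
    then have e: "q ^ (?N * (3 * ?N + 1) div 2) = q ^ (?N + ?N * (3 * ?N - 1) div 2)"
      by simp
    \<comment> \<open>The top term r = n + 1 has no partner in the sum for n; split off, it is what
      the telescoped boundary has to cancel.\<close>
    have "(\<Sum>r\<le>?N. qpoch q q ?N * f ?N r) =
        (\<Sum>r<?N. qpoch q q ?N * f ?N r - qpoch q q n * f n r) + (\<Sum>r\<le>n. qpoch q q n * f n r)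
        + qpoch q q ?N * f ?N ?N"
      by (simp add: sum_subtractf flip: lessThan_Suc_atMost)
    \<comment> \<open>At s = n + 1 the factor \<open>1 - q ^ s\<close> of the certificate completes
      \<open>qpoch q q n\<close> to \<open>qpoch q q ?N\<close>.\<close>
    also have "(\<Sum>r<?N. qpoch q q ?N * f ?N r - qpoch q q n * f n r) =
        - ((-1) ^ ?N * q ^ (?N + ?N * (3 * ?N - 1) div 2) * qpoch q q ?N / qpoch q q (?N + ?N))"
      unfolding f_def bailey_pair_telescope[OF assms order.refl]
      by (simp add: qpoch_Suc)
    also have "qpoch q q ?N * f ?N ?N =
        (-1) ^ ?N * q ^ (?N + ?N * (3 * ?N - 1) div 2) * qpoch q q ?N / qpoch q q (?N + ?N)"
    proof -
      have "qpoch q q (?N + ?N + 1) = qpoch q q (?N + ?N) * (1 - q ^ (2 * ?N + 1))"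
        by (simp add: qpoch_Suc mult_2)
      moreover have "1 - q ^ (2 * ?N + 1) \<noteq> 0"
        using one_minus_power_nonzero[OF assms, of "2 * ?N"] by simp
      ultimately show ?thesis
        unfolding f_def e diff_self_eq_0 qpoch_0 by simp
    qed
    finally show ?case
      using Suc.IH by simp
  qed
  then have "(\<Sum>r\<le>n. f n r) = 1 / qpoch q q n"
    using qpoch_nonzero[OF assms, of n]
    by (simp add: nonzero_eq_divide_eq mult.commute[of _ "qpoch q q n"] sum_distrib_left)
  then show ?thesis
    by (simp only: f_def)
qed

section \<open>The finite Jacobi triple product\<close>

text \<open>Triangular numbers with integer index. They are never negative, so \<open>nat\<close>
  truncates nothing and they can be exponents of a base that may be 0.\<close>

definition tri :: "int \<Rightarrow> nat" where
  "tri k = nat (k * (k + 1) div 2)"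

lemma int_tri: "2 * int (tri k) = k * (k + 1)"
proof -
  have "k * (k + 1) \<ge> 0"
    by (cases "k \<ge> 0") (auto intro: mult_nonpos_nonpos)
  moreover have "even (k * (k + 1))"
    by simp
  ultimately show ?thesis
    by (simp add: tri_def)
qed

lemma tri_int: "tri (int j) = j * (j + 1) div 2"
proof -
  have "int (2 * tri (int j)) = int (j * (j + 1))"
    by (simp only: of_nat_mult of_nat_numeral int_tri of_nat_add of_nat_1)
  then have "2 * tri (int j) = j * (j + 1)"
    by (simp only: of_nat_eq_iff)
  then show ?thesis
    by simp
qed

lemma tri_minus: "tri (- k) = tri (k - 1)"
  by (simp add: tri_def algebra_simps)

text \<open>The general term of Ramanujan's theta function f(-x, -y). Having two variables keeps
  both exponents nonnegative for every integer k.\<close>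

definition theta_term :: "complex \<Rightarrow> complex \<Rightarrow> int \<Rightarrow> complex" where
  "theta_term x y k = (if even k then 1 else -1) * x ^ tri k * y ^ tri (k - 1)"

text \<open>Passing from k to k + 1 raises the exponents of x and y by k + 1 and k. As these can be
  negative, the factor \<open>(x * y) ^ i\<close> compensates on the left.\<close>

lemma theta_term_shift:
  assumes "k + int i = int m"
  shows "(x * y) ^ i * theta_term x y (k + 1) = - (x ^ Suc m * y ^ m) * theta_term x y k"
proof -
  have "tri (k + 1) + i = tri k + Suc m" "tri k + i = tri (k - 1) + m"
    using int_tri[of k] int_tri[of "k + 1"] int_tri[of "k - 1"] assms
    by (simp_all add: algebra_simps)
  then have *: "x ^ tri (k + 1) * x ^ i = x ^ tri k * x ^ Suc m"
    "y ^ tri k * y ^ i = y ^ tri (k - 1) * y ^ m"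
    by (simp_all only: power_add[symmetric])
  have "(x * y) ^ i * theta_term x y (k + 1) =
      - (if even k then 1 else -1) * (x ^ tri (k + 1) * x ^ i) * (y ^ tri k * y ^ i)"
    by (simp add: theta_term_def power_mult_distrib)
  then show ?thesis
    unfolding * by (simp add: theta_term_def)
qed

text \<open>Induction on m with base \<open>q_binomial_theorem\<close> in base x y. In the step, the
  first sum of Pascal's rule is the old sum, and by \<open>theta_term_shift\<close> the second is
  the old sum times \<open>- (x ^ Suc m * y ^ m)\<close>.\<close>

lemma triple_product_finite:
  "(\<Prod>j<m. 1 - x ^ Suc j * y ^ j) * (\<Prod>j<n. 1 - x ^ j * y ^ Suc j) =
     (\<Sum>j\<le>m + n. qbin (x * y) (m + n) j * theta_term x y (int m - int j))"
proof (induction m)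
  case 0
  have "theta_term x y (- int j) = (- y) ^ j * (x * y) ^ (j * (j - 1) div 2)" for j
  proof -
    have "j * (j + 1) div 2 = j * (j - 1) div 2 + j"
      by (cases j) auto
    then have "tri (- int j - 1) = j * (j - 1) div 2 + j"
      using tri_minus[of "int j + 1"] by (simp add: tri_int)
    moreover have "tri (- int j) = j * (j - 1) div 2"
      unfolding tri_minus using tri_int[of "j - 1"] by (cases j) (auto simp: tri_def)
    ultimately show ?thesis
      by (simp add: theta_term_def power_mult_distrib power_add power_minus[of y j])
  qed
  then show ?case
    using q_binomial_theorem[of y "x * y" n] by (simp add: power_mult_distrib mult_ac)
next
  case (Suc m)
  have shift: "(x * y) ^ j * theta_term x y (int (Suc m) - int j) =
      - (x ^ Suc m * y ^ m) * theta_term x y (int m - int j)" for j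
    using theta_term_shift[of "int m - int j" j m x y] by (simp add: algebra_simps)
  have "(\<Sum>j\<le>Suc (m + n). qbin (x * y) (Suc (m + n)) j * theta_term x y (int (Suc m) - int j)) =
      (1 - x ^ Suc m * y ^ m) *
      (\<Sum>j\<le>m + n. qbin (x * y) (m + n) j * theta_term x y (int m - int j))"
    unfolding sum_qbin_Suc mult.commute[of "(x * y) ^ _" "qbin _ _ _"] mult.assoc shift
    by (simp add: algebra_simps sum_negf flip: sum_distrib_left)
  then show ?case
    using Suc.IH by (simp add: mult_ac)
qed

text \<open>Reflection about the middle: the number of terms is even, so no term stays
  alone.\<close>

lemma sum_atMost_fold:
  fixes f :: "nat \<Rightarrow> 'a :: comm_monoid_add"
  shows "(\<Sum>j\<le>m + Suc m. f j) = (\<Sum>r\<le>m. f (m - r) + f (m + Suc r))"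
proof -
  have "(\<Sum>j\<le>m + Suc m. f j) = (\<Sum>j\<le>m. f j) + (\<Sum>j=Suc m..m + Suc m. f j)"
    by (rule sum_up_index_split)
  also have "(\<Sum>j=Suc m..m + Suc m. f j) = (\<Sum>r\<le>m. f (m + Suc r))"
    by (rule sum.reindex_bij_witness[of _ "\<lambda>r. m + Suc r" "\<lambda>j. j - Suc m"]) auto
  also have "(\<Sum>j\<le>m. f j) = (\<Sum>r\<le>m. f (m - r))"
    by (rule sum.reindex_bij_witness[of _ "\<lambda>r. m - r" "\<lambda>j. m - j"]) auto
  finally show ?thesis
    by (simp add: sum.distrib)
qed

text \<open>The terms with index \<open>r\<close> and \<open>- r - 1\<close> carry the same binomial coefficient, so they are combined.\<close>

lemma triple_product_finite_folded:
  assumes "norm (x * y) < 1"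
  shows "(\<Prod>j<m. 1 - x ^ Suc j * y ^ j) * (\<Prod>j<Suc m. 1 - x ^ j * y ^ Suc j) =
     (\<Sum>r\<le>m. qbin (x * y) (m + Suc m) (m - r) *
        ((-1) ^ r * x ^ (r * (r + 1) div 2) * y ^ (r * (r - 1) div 2) * (1 - y ^ (2 * r + 1))))"
proof -
  have "qbin (x * y) (m + Suc m) (m - r) * theta_term x y (int m - int (m - r)) +
        qbin (x * y) (m + Suc m) (m + Suc r) * theta_term x y (int m - int (m + Suc r)) =
      qbin (x * y) (m + Suc m) (m - r) *
        ((-1) ^ r * x ^ (r * (r + 1) div 2) * y ^ (r * (r - 1) div 2) * (1 - y ^ (2 * r + 1)))"
    if "r \<le> m" for r
  proof -
    \<comment> \<open>Symmetry of the Gaussian binomial: the two lower indices add up to 2m +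
      1.\<close>
    have b: "qbin (x * y) (m + Suc m) (m + Suc r) = qbin (x * y) (m + Suc m) (m - r)"
    proof -
      have "m + Suc m - (m + Suc r) = m - r" "m + Suc m - (m - r) = m + Suc r"
        "m + Suc r \<le> m + Suc m" "m - r \<le> m + Suc m"
        using that by auto
      then show ?thesis
        by (simp only: qbin_eq[OF assms] mult.commute)
    qed
    have t: "tri (int r - 1) = r * (r - 1) div 2"
      using tri_int[of "r - 1"] by (cases r) (auto simp: tri_def)
    \<comment> \<open>At k = -r - 1 the exponent of y exceeds that at k = r by 2r + 1, the exponent
      of x is the same and the sign is opposite; hence the factor
      \<open>1 - y ^ (2 * r + 1)\<close>.\<close>
    have *: "(r + 1) * (r + 2) div 2 = r * (r - 1) div 2 + (2 * r + 1)"
      by (cases r) (auto simp: algebra_simps)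
    have "tri (- int r - 1 - 1) = r * (r - 1) div 2 + (2 * r + 1)"
    proof -
      have "- int r - 1 - 1 = - (int r + 2)" "int r + 2 - 1 = int (r + 1)" "r + 1 + 1 = r + 2"
        by auto
      then show ?thesis
        using * by (simp only: tri_minus tri_int)
    qed
    moreover have "tri (- int r - 1) = r * (r + 1) div 2"
      using tri_minus[of "int r + 1"] by (simp add: tri_int)
    ultimately have theta1: "theta_term x y (- int r - 1) =
        - ((-1) ^ r * x ^ (r * (r + 1) div 2) * (y ^ (r * (r - 1) div 2) * y ^ (2 * r + 1)))"
      by (simp add: theta_term_def power_add)
    have theta0: "theta_term x y (int r) =
        (-1) ^ r * x ^ (r * (r + 1) div 2) * y ^ (r * (r - 1) div 2)"
      by (simp add: theta_term_def t tri_int)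
    have index: "int m - int (m + Suc r) = - int r - 1" "int m - int (m - r) = int r"
      using that by auto
    show ?thesis
      unfolding b index theta0 theta1 by (simp add: right_diff_distrib mult.assoc)
  qed
  then show ?thesis
    unfolding triple_product_finite sum_atMost_fold by (intro sum.cong) auto
qed

section \<open>Limits and uniform bounds\<close>

lemma qpoch_tendsto:
  assumes "norm q < 1"
  shows "qpoch x q \<longlonglongrightarrow> qpoch_inf x q"
proof -
  have "(\<lambda>n. qpoch x q (Suc n)) \<longlonglongrightarrow> qpoch_inf x q"
    using convergent_prod_LIMSEQ[OF convergent_prod_qpoch_inf[OF assms, of x]]
    by (simp add: qpoch_def qpoch_inf_def lessThan_Suc_atMost del: prod.lessThan_Suc)
  then show ?thesis
    by (simp add: filterlim_sequentially_Suc)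
qed

lemma qpoch_inf_nonzero:
  assumes "norm q < 1"
  shows "qpoch_inf q q \<noteq> 0"
  unfolding qpoch_inf_def
  using one_minus_power_nonzero[OF assms]
  by (intro prodinf_nonzero convergent_prod_qpoch_inf assms) simp

text \<open>Both sequences converge, the reciprocals because the limit is nonzero. The uniform
  constant provides the majorants for Tannery's theorem and for the double series.\<close>

lemma qpoch_bounds:
  assumes "norm q < 1"
  obtains C where "C > 0" "\<And>n. norm (qpoch q q n) \<le> C" "\<And>n. norm (1 / qpoch q q n) \<le> C"
proof -
  have lim: "qpoch q q \<longlonglongrightarrow> qpoch_inf q q"
    by (rule qpoch_tendsto[OF assms])
  then have "Bseq (qpoch q q)"
    by (intro convergent_imp_Bseq convergentI)
  then obtain A where A: "A > 0" "\<And>n. norm (qpoch q q n) \<le> A"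
    by (auto elim: BseqE)
  have "(\<lambda>n. 1 / qpoch q q n) \<longlonglongrightarrow> 1 / qpoch_inf q q"
    by (intro tendsto_intros lim qpoch_inf_nonzero assms)
  then have "Bseq (\<lambda>n. 1 / qpoch q q n)"
    by (intro convergent_imp_Bseq convergentI)
  then obtain B where B: "B > 0" "\<And>n. norm (1 / qpoch q q n) \<le> B"
    by (auto elim: BseqE)
  show thesis
    using that[of "max A B"] A B by (auto simp: le_max_iff_disj)
qed

lemma qbin_bounded:
  assumes "norm q < 1"
  obtains C where "C > 0" "\<And>n k. norm (qbin q n k) \<le> C"
proof -
  obtain C where C: "C > 0" "\<And>n. norm (qpoch q q n) \<le> C" "\<And>n. norm (1 / qpoch q q n) \<le> C"
    using qpoch_bounds[OF assms] by metis
  have "norm (qbin q n k) \<le> C * C * C" for n k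
  proof (cases "k \<le> n")
    case True
    have "norm (qbin q n k) =
        norm (qpoch q q n) * norm (1 / qpoch q q k) * norm (1 / qpoch q q (n - k))"
      by (simp add: qbin_eq[OF assms True] norm_mult norm_divide)
    also have "\<dots> \<le> C * C * C"
      using C by (intro mult_mono mult_nonneg_nonneg) (auto intro: less_imp_le)
    finally show ?thesis .
  qed (use C in \<open>simp add: qbin_eq_0\<close>)
  then show thesis
    using that[of "C * C * C"] C by simp
qed

lemma qbin_tendsto:
  assumes "norm q < 1"
  shows "(\<lambda>n. qbin q n k) \<longlonglongrightarrow> 1 / qpoch q q k"
proof -
  note lim = qpoch_tendsto[OF assms, of q]
  have "(\<lambda>n. qpoch q q n / (qpoch q q k * qpoch q q (n - k)))
      \<longlonglongrightarrow> qpoch_inf q q / (qpoch q q k * qpoch_inf q q)"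
    using qpoch_nonzero[OF assms] qpoch_inf_nonzero[OF assms]
    by (intro tendsto_intros lim filterlim_compose[OF lim filterlim_minus_const_nat_at_top]) auto
  moreover have "eventually (\<lambda>n. qpoch q q n / (qpoch q q k * qpoch q q (n - k)) = qbin q n k) sequentially"
    using eventually_ge_at_top[of k] by eventually_elim (simp add: qbin_eq[OF assms])
  ultimately show ?thesis
    using qpoch_inf_nonzero[OF assms] by (simp add: tendsto_cong)
qed

text \<open>The upper and both complementary lower indices tend to infinity, so r disappears from
  the limit; this is the source of the factor (xy; xy)_inf in the triple product.\<close>

lemma qbin_middle_tendsto:
  assumes "norm q < 1"
  shows "(\<lambda>m. qbin q (m + Suc m) (m - r)) \<longlonglongrightarrow> 1 / qpoch_inf q q"
proof -
  note lim = qpoch_tendsto[OF assms, of q]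
  have "filterlim (\<lambda>m::nat. m + Suc m) sequentially sequentially"
       "filterlim (\<lambda>m::nat. m + Suc r) sequentially sequentially"
    by (rule filterlim_at_top_mono[OF filterlim_ident], simp)+
  then have "(\<lambda>m. qpoch q q (m + Suc m) / (qpoch q q (m - r) * qpoch q q (m + Suc r)))
      \<longlonglongrightarrow> qpoch_inf q q / (qpoch_inf q q * qpoch_inf q q)"
    using qpoch_inf_nonzero[OF assms]
    by (intro tendsto_intros filterlim_compose[OF lim] filterlim_minus_const_nat_at_top) auto
  moreover have "eventually (\<lambda>m. qpoch q q (m + Suc m) /
      (qpoch q q (m - r) * qpoch q q (m + Suc r)) = qbin q (m + Suc m) (m - r)) sequentially"
    using eventually_ge_at_top[of r]
  proof eventually_elim
    case (elim m)
    then have "m + Suc m - (m - r) = m + Suc r" "m - r \<le> m + Suc m"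
      by auto
    then show ?case
      by (simp only: qbin_eq[OF assms])
  qed
  ultimately show ?thesis
    using qpoch_inf_nonzero[OF assms] by (simp add: tendsto_cong)
qed

section \<open>Tannery's theorem and the infinite Durfee and triple product identities\<close>

text \<open>Dominated convergence for finite sums of growing length: \<open>zero\<close> lets each
  of them be read as an infinite series. The majorant also gives absolute convergence, hence
  \<open>has_sum\<close> instead of mere \<open>sums\<close>.\<close>

lemma tannery_has_sum:
  fixes a :: "nat \<Rightarrow> nat \<Rightarrow> 'a :: {real_normed_algebra, banach}"
  assumes lim: "\<And>k. a k \<longlonglongrightarrow> b k"
    and bound: "\<And>k n. norm (a k n) \<le> M k" and M: "summable M"
    and zero: "\<And>k n. k > n \<Longrightarrow> a k n = 0"
    and sum: "(\<lambda>n. \<Sum>k\<le>n. a k n) \<longlonglongrightarrow> L"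
  shows "(b has_sum L) UNIV"
proof -
  have T: "summable (\<lambda>k. norm (b k)) \<and> (\<lambda>n. suminf (\<lambda>k. a k n)) \<longlonglongrightarrow> suminf b"
  proof -
    have "eventually (\<lambda>(k, n). norm (a k n) \<le> M k) (sequentially \<times>\<^sub>F sequentially)"
      using bound by (intro always_eventually) auto
    from tannerys_theorem[of a b, OF lim this M sequentially_bot] show ?thesis
      by blast
  qed
  have "suminf (\<lambda>k. a k n) = (\<Sum>k\<le>n. a k n)" for n
    by (rule suminf_finite) (auto simp: zero not_le)
  then have "L = suminf b"
    using T sum by (auto intro: LIMSEQ_unique)
  then have "b sums L"
    using T by (auto intro: summable_sums summable_norm_cancel)
  then show ?thesis
    using T by (auto intro: norm_summable_imp_has_sum)
qed

theorem durfee_rectangle: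
  assumes "norm q < 1"
  shows "((\<lambda>l. q ^ (l * (l + a)) / (qpoch q q l * qpoch q q (l + a))) has_sum 1 / qpoch_inf q q) UNIV"
proof -
  obtain B where B: "B > 0" "\<And>n k. norm (qbin q n k) \<le> B"
    using qbin_bounded[OF assms] by metis
  obtain C where C: "C > 0" "\<And>n. norm (1 / qpoch q q n) \<le> C"
    using qpoch_bounds[OF assms] by metis
  have "((\<lambda>l. 1 / qpoch q q l * (q ^ (l * (l + a)) / qpoch q q (l + a))) has_sum 1 / qpoch_inf q q) UNIV"
  proof (rule tannery_has_sum)
    show "(\<lambda>n. qbin q n l * (q ^ (l * (l + a)) / qpoch q q (l + a)))
        \<longlonglongrightarrow> 1 / qpoch q q l * (q ^ (l * (l + a)) / qpoch q q (l + a))" for l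
      by (intro tendsto_mult_right qbin_tendsto assms)
    show "norm (qbin q n l * (q ^ (l * (l + a)) / qpoch q q (l + a))) \<le> B * (norm q ^ l * C)" for l n
    proof -
      have "norm (qbin q n l * (q ^ (l * (l + a)) / qpoch q q (l + a))) =
          norm (qbin q n l) * (norm q ^ (l * (l + a)) * norm (1 / qpoch q q (l + a)))"
        by (simp add: norm_mult norm_divide norm_power)
      \<comment> \<open>Since l \<le> l (l + a), a geometric series dominates.\<close>
      also have "\<dots> \<le> B * (norm q ^ l * C)"
        using B C assms
        by (intro mult_mono power_decreasing mult_nonneg_nonneg) (auto intro: less_imp_le)
      finally show ?thesis .
    qed
    show "summable (\<lambda>l. B * (norm q ^ l * C))"
      using assms by (intro summable_mult summable_mult2 summable_geometric) simp
    show "qbin q n l * (q ^ (l * (l + a)) / qpoch q q (l + a)) = 0" if "l > n" for l n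
      using that by (simp add: qbin_eq_0)
    show "(\<lambda>n. \<Sum>l\<le>n. qbin q n l * (q ^ (l * (l + a)) / qpoch q q (l + a))) \<longlonglongrightarrow> 1 / qpoch_inf q q"
      unfolding durfee_rectangle_finite[OF assms]
      by (intro tendsto_divide tendsto_const LIMSEQ_ignore_initial_segment[OF qpoch_tendsto]
          qpoch_inf_nonzero assms)
  qed
  then show ?thesis
    by simp
qed

text \<open>The limit m \<rightarrow> \<infinity> of \<open>triple_product_finite_folded\<close>;
  the bilateral theta series stays folded into a series over the natural numbers.\<close>

theorem jacobi_triple_product_folded:
  assumes "norm x < 1" "norm y < 1"
  shows "((\<lambda>r. (-1) ^ r * x ^ (r * (r + 1) div 2) * y ^ (r * (r - 1) div 2) * (1 - y ^ (2 * r + 1)))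
    has_sum qpoch_inf (x * y) (x * y) * qpoch_inf x (x * y) * qpoch_inf y (x * y)) UNIV"
proof -
  define p where "p = x * y"
  define t where "t = (\<lambda>r. (-1) ^ r * x ^ (r * (r + 1) div 2) * y ^ (r * (r - 1) div 2) * (1 - y ^ (2 * r + 1)))"
  have p: "norm p < 1"
    using mult_strict_mono'[of "norm x" 1 "norm y" 1] assms by (simp add: p_def norm_mult)
  obtain B where B: "B > 0" "\<And>n k. norm (qbin p n k) \<le> B"
    using qbin_bounded[OF p] by metis
  have "((\<lambda>r. 1 / qpoch_inf p p * t r) has_sum qpoch_inf x p * qpoch_inf y p) UNIV"
  proof (rule tannery_has_sum)
    \<comment> \<open>For r > m the truncated difference \<open>m - r\<close> is 0 and the binomial
      would be 1, so the cut-off has to be explicit.\<close>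
    show "(\<lambda>m. if r \<le> m then qbin p (m + Suc m) (m - r) * t r else 0)
        \<longlonglongrightarrow> 1 / qpoch_inf p p * t r" for r
    proof -
      have "eventually (\<lambda>m. qbin p (m + Suc m) (m - r) * t r =
          (if r \<le> m then qbin p (m + Suc m) (m - r) * t r else 0)) sequentially"
        using eventually_ge_at_top[of r] by eventually_elim simp
      moreover have "(\<lambda>m. qbin p (m + Suc m) (m - r) * t r) \<longlonglongrightarrow> 1 / qpoch_inf p p * t r"
        by (intro tendsto_mult_right qbin_middle_tendsto p)
      ultimately show ?thesis
        by (rule Lim_transform_eventually[rotated])
    qed
    show "norm (if r \<le> m then qbin p (m + Suc m) (m - r) * t r else 0) \<le> B * (norm x ^ r * 1 * 2)" for r m
    proof -
      \<comment> \<open>This makes the power of x geometrically small; the factors in y are bounded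
        by 1 and 2.\<close>
      have "r \<le> r * (r + 1) div 2"
        by (cases r) auto
      moreover have "norm (1 - y ^ (2 * r + 1)) \<le> 2"
        using norm_triangle_ineq4[of 1 "y ^ (2 * r + 1)"] power_le_one[of "norm y" "2 * r + 1"] assms
        by (simp add: norm_power del: power_Suc)
      moreover have "norm y ^ (r * (r - 1) div 2) \<le> 1"
        using assms by (intro power_le_one) auto
      moreover have "norm (t r) =
          norm x ^ (r * (r + 1) div 2) * norm y ^ (r * (r - 1) div 2) * norm (1 - y ^ (2 * r + 1))"
        by (simp only: t_def norm_mult norm_power norm_minus_cancel norm_one power_one mult_1_left)
      ultimately have "norm (t r) \<le> norm x ^ r * 1 * 2"
        using assms by (simp only:) (intro mult_mono power_decreasing; simp)
      then have "norm (qbin p (m + Suc m) (m - r)) * norm (t r) \<le> B * (norm x ^ r * 1 * 2)"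
        using B by (intro mult_mono) (auto intro: less_imp_le)
      moreover have "0 \<le> B * (norm x ^ r * 1 * 2)"
        using B(1) by simp
      ultimately show ?thesis
        by (simp only: norm_mult norm_zero split: if_split) simp
    qed
    show "summable (\<lambda>r. B * (norm x ^ r * 1 * 2))"
      using assms by (intro summable_mult summable_mult2 summable_geometric) simp
    show "(if r \<le> m then qbin p (m + Suc m) (m - r) * t r else 0) = 0" if "r > m" for r m
      using that by simp
    have "(\<Sum>r\<le>m. if r \<le> m then qbin p (m + Suc m) (m - r) * t r else 0) =
        qpoch x p m * qpoch y p (Suc m)" for m
    proof -
      have "(\<Sum>r\<le>m. if r \<le> m then qbin p (m + Suc m) (m - r) * t r else 0) =
          (\<Sum>r\<le>m. qbin p (m + Suc m) (m - r) * t r)"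
        by simp
      also have "\<dots> = (\<Prod>j<m. 1 - x ^ Suc j * y ^ j) * (\<Prod>j<Suc m. 1 - x ^ j * y ^ Suc j)"
        using triple_product_finite_folded[of x y m] p by (simp only: t_def p_def)
      also have "\<dots> = qpoch x p m * qpoch y p (Suc m)"
        unfolding qpoch_def p_def
        by (intro arg_cong2[where f = times] prod.cong) (simp_all add: power_mult_distrib mult_ac)
      finally show ?thesis .
    qed
    then show "(\<lambda>m. \<Sum>r\<le>m. if r \<le> m then qbin p (m + Suc m) (m - r) * t r else 0)
        \<longlonglongrightarrow> qpoch_inf x p * qpoch_inf y p"
      by (simp only:) (intro tendsto_mult qpoch_tendsto LIMSEQ_Suc[OF qpoch_tendsto] p)
  qed
  then have "((\<lambda>r. qpoch_inf p p * (1 / qpoch_inf p p * t r)) has_sum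
      qpoch_inf p p * (qpoch_inf x p * qpoch_inf y p)) UNIV"
    by (rule has_sum_cmult_right)
  moreover have "(\<lambda>r. qpoch_inf p p * (1 / qpoch_inf p p * t r)) = t"
    using qpoch_inf_nonzero[OF p] by simp
  ultimately have "(t has_sum qpoch_inf p p * qpoch_inf x p * qpoch_inf y p) UNIV"
    by (simp only: mult.assoc)
  then show ?thesis
    by (simp only: t_def p_def)
qed

section \<open>The sum side of the second Rogers-Ramanujan identity\<close>

text \<open>Justifies the iterated summations of both double series below by absolute
  convergence.\<close>

lemma summable_on_double_geometric:
  fixes f :: "nat \<times> nat \<Rightarrow> 'a :: banach" and r :: real
  assumes r: "0 \<le> r" "r < 1" and "C \<ge> 0"
    and bound: "\<And>n l. norm (f (n, l)) \<le> C * (r ^ n * r ^ l)"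
  shows "f summable_on UNIV \<times> UNIV"
proof -
  have "norm (r ^ l) = r ^ l" for l
    using r by simp
  moreover have "summable (\<lambda>l. r ^ l)"
    by (rule summable_geometric) (use r in simp)
  ultimately have "summable (\<lambda>l. norm (r ^ l))"
    by (simp only:)
  moreover have "(\<lambda>l. r ^ l) sums (1 / (1 - r))"
    by (rule geometric_sums) (use r in simp)
  ultimately have g: "((\<lambda>l. r ^ l) has_sum 1 / (1 - r)) UNIV"
    by (rule norm_summable_imp_has_sum)
  have "(\<lambda>z. C * (r ^ fst z * r ^ snd z)) summable_on UNIV \<times> UNIV"
  proof (rule summable_on_SigmaI)
    show "((\<lambda>l. C * (r ^ fst (n, l) * r ^ snd (n, l))) has_sum C * (r ^ n * (1 / (1 - r)))) UNIV" for n
      unfolding fst_conv snd_conv by (intro has_sum_cmult_right g)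
    show "(\<lambda>n. C * (r ^ n * (1 / (1 - r)))) summable_on UNIV"
      using g by (intro summable_on_cmult_right summable_on_cmult_left has_sum_imp_summable)
    show "C * (r ^ fst (n, l) * r ^ snd (n, l)) \<ge> 0" for n l
      by (intro mult_nonneg_nonneg zero_le_power r \<open>C \<ge> 0\<close>)
  qed
  then have "(\<lambda>z. norm (f z)) summable_on UNIV \<times> UNIV"
  proof (rule Infinite_Sum.abs_summable_on_comparison_test')
    show "norm (f z) \<le> C * (r ^ fst z * r ^ snd z)" for z
      using bound[of "fst z" "snd z"] by (simp only: prod.collapse)
  qed
  then show ?thesis
    by (rule abs_summable_summable)
qed

text \<open>One double family \<open>h\<close> is summed in two ways: over l for fixed r the Durfee
  identity leaves a theta series, and along the diagonals r + l = n the Bailey pair restores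
  \<open>1 / qpoch q q n\<close>.\<close>

lemma sum_eq_theta_quotient:
  assumes "norm q < 1"
  shows "((\<lambda>n. q ^ (n\<^sup>2 + n) / qpoch q q n) has_sum
           (qpoch_inf (q ^ 5) (q ^ 5) * qpoch_inf (q ^ 4) (q ^ 5) * qpoch_inf q (q ^ 5) / qpoch_inf q q)) UNIV"
proof -
  define c where "c = (\<lambda>r. (-1) ^ r * q ^ (r * (3 * r + 1) div 2) * (1 - q ^ (2 * r + 1)))"
  \<comment> \<open>The substitution n = r + l in the Bailey expansion turns n - r into l and n + r
    + 1 into l + (2r + 1), with (r, l) ranging over all pairs.\<close>
  define h where "h = (\<lambda>(r, l). q ^ ((r + l)\<^sup>2 + (r + l)) * c r / (qpoch q q l * qpoch q q (l + (2 * r + 1))))"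
  obtain C where C: "C > 0" "\<And>n. norm (1 / qpoch q q n) \<le> C"
    using qpoch_bounds[OF assms] by metis
  have "h summable_on UNIV \<times> UNIV"
  proof (rule summable_on_double_geometric)
    fix r l
    have "norm (1 - q ^ (2 * r + 1)) \<le> 2"
      using norm_triangle_ineq4[of 1 "q ^ (2 * r + 1)"] power_le_one[of "norm q" "2 * r + 1"] assms
      by (simp add: norm_power del: power_Suc)
    then have c: "norm (c r) \<le> 1 * 1 * 2"
      unfolding c_def norm_mult norm_power using assms
      by (intro mult_mono mult_nonneg_nonneg) (auto intro: power_le_one)
    have "norm (h (r, l)) = norm q ^ ((r + l)\<^sup>2 + (r + l)) * norm (c r) *
        (norm (1 / qpoch q q l) * norm (1 / qpoch q q (l + (2 * r + 1))))"
      by (simp add: h_def norm_mult norm_divide norm_power)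
    also have "\<dots> \<le> norm q ^ (r + l) * 2 * (C * C)"
      using C c assms
      by (intro mult_mono power_decreasing mult_nonneg_nonneg) (auto intro: less_imp_le)
    finally show "norm (h (r, l)) \<le> (2 * C * C) * (norm q ^ r * norm q ^ l)"
      by (simp add: power_add mult_ac)
  qed (use assms C in auto)
  then obtain T where T: "(h has_sum T) (UNIV \<times> UNIV)"
    by (auto simp: summable_on_def)
  have inner: "((\<lambda>l. h (r, l)) has_sum q ^ (r\<^sup>2 + r) * c r * (1 / qpoch_inf q q)) UNIV" for r
  proof -
    have "h (r, l) = q ^ (r\<^sup>2 + r) * c r *
        (q ^ (l * (l + (2 * r + 1))) / (qpoch q q l * qpoch q q (l + (2 * r + 1))))" for l
    proof -
      have "(r + l)\<^sup>2 + (r + l) = r\<^sup>2 + r + l * (l + (2 * r + 1))"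
        by (simp add: power2_eq_square algebra_simps)
      then have "q ^ ((r + l)\<^sup>2 + (r + l)) = q ^ (r\<^sup>2 + r) * q ^ (l * (l + (2 * r + 1)))"
        by (simp only: power_add)
      then show ?thesis
        by (simp only: h_def prod.case times_divide_eq_right mult_ac)
    qed
    then show ?thesis
      by (simp only:) (intro has_sum_cmult_right durfee_rectangle assms)
  qed
  have theta: "((\<lambda>r. q ^ (r\<^sup>2 + r) * c r * (1 / qpoch_inf q q)) has_sum T) UNIV"
    using has_sum_SigmaD[OF T inner] by simp

  \<comment> \<open>The total exponent (5 r^2 + 3 r) / 2 equals 4 r (r + 1) / 2 + r (r - 1) / 2, so
    the triple product applies with x = q^4 and y = q.\<close>
  have summand: "q ^ (r\<^sup>2 + r) * c r =
      (-1) ^ r * (q ^ 4) ^ (r * (r + 1) div 2) * q ^ (r * (r - 1) div 2) * (1 - q ^ (2 * r + 1))" for r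
  proof -
    have "even (r * (r + 1))" "even (r * (r - 1))" "even (r * (3 * r + 1))"
      by auto
    then have half: "2 * (r * (r + 1) div 2) = r * (r + 1)" "2 * (r * (r - 1) div 2) = r * (r - 1)"
        "2 * (r * (3 * r + 1) div 2) = r * (3 * r + 1)"
      by (simp_all only: dvd_mult_div_cancel)
    have double: "2 * (r\<^sup>2 + r) + r * (3 * r + 1) = 4 * (r * (r + 1)) + r * (r - 1)"
      by (cases r) (auto simp: power2_eq_square algebra_simps)
    have halve: "p + c = 4 * a + b"
      if "2 * a = x" "2 * b = y" "2 * c = z" "2 * p + z = 4 * x + y" for a b c p x y z :: nat
      using that by linarith
    have "r\<^sup>2 + r + r * (3 * r + 1) div 2 = 4 * (r * (r + 1) div 2) + r * (r - 1) div 2"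
      by (rule halve[OF half double])
    then have "q ^ (r\<^sup>2 + r) * q ^ (r * (3 * r + 1) div 2) =
        (q ^ 4) ^ (r * (r + 1) div 2) * q ^ (r * (r - 1) div 2)"
      by (simp only: flip: power_add power_mult)
    then show ?thesis
      by (simp add: c_def mult_ac)
  qed
  have "norm (q ^ 4) < 1"
    using assms by (simp add: norm_power power_less_one_iff)
  moreover have "q ^ 4 * q = q ^ 5"
    by (simp only: eval_nat_numeral power_Suc2)
  ultimately have "((\<lambda>r. q ^ (r\<^sup>2 + r) * c r) has_sum
      qpoch_inf (q ^ 5) (q ^ 5) * qpoch_inf (q ^ 4) (q ^ 5) * qpoch_inf q (q ^ 5)) UNIV"
    using jacobi_triple_product_folded[of "q ^ 4" q, OF _ assms] by (simp only: summand)
  \<comment> \<open>Both are values of the same series over r, which determines the total T of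
    \<open>h\<close>.\<close>
  from has_sum_unique[OF theta has_sum_cmult_left[OF this, of "1 / qpoch_inf q q"]]
  have T_eq: "T = qpoch_inf (q ^ 5) (q ^ 5) * qpoch_inf (q ^ 4) (q ^ 5) * qpoch_inf q (q ^ 5) / qpoch_inf q q"
    by simp

  \<comment> \<open>Back to the diagonals n = r + l, where 0 \<le> r \<le> n.\<close>
  have "bij_betw (\<lambda>(n, r). (r, n - r)) (SIGMA n:UNIV. {..n}) (UNIV \<times> UNIV :: (nat \<times> nat) set)"
    by (rule bij_betwI[where g = "\<lambda>(r, l). (r + l, r)"]) auto
  from has_sum_reindex_bij_betw[OF this, of h T] T
  have pairs: "((\<lambda>z. h (case z of (n, r) \<Rightarrow> (r, n - r))) has_sum T) (SIGMA n:UNIV. {..n})"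
    by (simp only:)
  have "((\<lambda>r. h (r, n - r)) has_sum q ^ (n\<^sup>2 + n) / qpoch q q n) {..n}" for n
  proof (rule has_sum_finiteI)
    have "h (r, n - r) = q ^ (n\<^sup>2 + n) * ((-1) ^ r * q ^ (r * (3 * r + 1) div 2) * (1 - q ^ (2 * r + 1)) /
        (qpoch q q (n - r) * qpoch q q (n + r + 1)))" if "r \<le> n" for r
    proof -
      have "n - r + (2 * r + 1) = n + r + 1" "r + (n - r) = n"
        using that by auto
      then show ?thesis
        by (simp only: h_def c_def prod.case) simp
    qed
    then have "(\<Sum>r\<le>n. h (r, n - r)) = q ^ (n\<^sup>2 + n) * (1 / qpoch q q n)"
      by (simp only: bailey_pair[OF assms, symmetric] sum_distrib_left) (rule sum.cong, auto)
    then show "q ^ (n\<^sup>2 + n) / qpoch q q n = (\<Sum>r\<le>n. h (r, n - r))"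
      by simp
  qed simp
  then have "((\<lambda>n. q ^ (n\<^sup>2 + n) / qpoch q q n) has_sum T) UNIV"
    by (intro has_sum_SigmaD[OF pairs]) (simp only: prod.case)
  then show ?thesis
    by (simp only: T_eq)
qed

section \<open>The product side modulo 5\<close>

definition rr_residue :: "nat \<Rightarrow> bool" where
  "rr_residue m \<longleftrightarrow> m \<ge> 1 \<and> \<not> [int m = 0] (mod 5) \<and> \<not> [int m = 1] (mod 5) \<and> \<not> [int m = - 1] (mod 5)"

lemma rr_residue_iff: "rr_residue m \<longleftrightarrow> m mod 5 = 2 \<or> m mod 5 = 3"
proof -
  define k where "k = m mod 5"
  have m: "int m mod 5 = int k"
    by (simp add: k_def zmod_int)
  have pos: "m \<ge> 1" if "k \<noteq> 0"
    using that by (cases m) (auto simp: k_def)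
  have "k < 5"
    by (simp add: k_def)
  then consider "k = 0" | "k = 1" | "k = 2" | "k = 3" | "k = 4"
    by linarith
  then show ?thesis
    unfolding rr_residue_def cong_def m k_def[symmetric] by cases (use pos in simp_all)
qed

text \<open>Split by residues modulo 5, the three numerator products cancel the classes 0, 4 and 1
  of (q; q)_inf, leaving 2 and 3 in the denominator. This is exact for blocks of five factors, then
  n \<rightarrow> \<infinity>.\<close>

lemma theta_quotient_eq_prodinf:
  assumes "norm q < 1"
  shows "qpoch_inf (q ^ 5) (q ^ 5) * qpoch_inf (q ^ 4) (q ^ 5) * qpoch_inf q (q ^ 5) / qpoch_inf q q =
    (\<Prod>m. if rr_residue m then 1 / (1 - q ^ m) else 1)"
proof -
  let ?w = "\<lambda>m. if rr_residue m then 1 / (1 - q ^ m) else 1"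
  \<comment> \<open>\<open>qpoch q q (5 * n)\<close> involves the exponents 1 to 5n, but the product
    of \<open>?w\<close> the indices 0 to 5n - 1; they differ only in multiples of 5, where
    \<open>?w\<close> is 1.\<close>
  have finite: "qpoch q q (5 * n) * (\<Prod>m<5 * n. ?w m) =
      qpoch (q ^ 5) (q ^ 5) n * qpoch (q ^ 4) (q ^ 5) n * qpoch q (q ^ 5) n" for n
  proof (induction n)
    case (Suc n)
    define z where "z = q ^ (5 * n)"
    have z: "(q ^ 5) ^ n = z"
      by (simp add: z_def power_mult)
    have nz: "1 - q ^ 2 * z \<noteq> 0" "1 - q ^ 3 * z \<noteq> 0"
      using one_minus_power_nonzero[OF assms, of "5 * n + 1"]
        one_minus_power_nonzero[OF assms, of "5 * n + 2"]
      by (simp_all add: z_def power2_eq_square power3_eq_cube mult_ac)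
    have five: "5 * Suc n = Suc (Suc (Suc (Suc (Suc (5 * n)))))"
      by simp
    have P: "qpoch q q (5 * Suc n) =
        qpoch q q (5 * n) * (1 - q * z) * (1 - q ^ 2 * z) * (1 - q ^ 3 * z) * (1 - q ^ 4 * z) * (1 - q ^ 5 * z)"
      unfolding five qpoch_Suc by (simp add: z_def eval_nat_numeral mult_ac)
    have "\<not> rr_residue (5 * n)" "\<not> rr_residue (Suc (5 * n))" "rr_residue (Suc (Suc (5 * n)))"
        "rr_residue (Suc (Suc (Suc (5 * n))))" "\<not> rr_residue (Suc (Suc (Suc (Suc (5 * n)))))"
      by (simp_all add: rr_residue_iff mod_Suc)
    then have W: "(\<Prod>m<5 * Suc n. ?w m) = (\<Prod>m<5 * n. ?w m) * (1 / (1 - q ^ 2 * z)) * (1 / (1 - q ^ 3 * z))"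
      unfolding five prod.lessThan_Suc by (simp add: z_def eval_nat_numeral mult_ac)
    have "qpoch q q (5 * Suc n) * (\<Prod>m<5 * Suc n. ?w m) =
        (qpoch q q (5 * n) * (\<Prod>m<5 * n. ?w m)) * ((1 - q * z) * (1 - q ^ 4 * z) * (1 - q ^ 5 * z))"
      unfolding P W using nz by simp
    also have "\<dots> = qpoch (q ^ 5) (q ^ 5) (Suc n) * qpoch (q ^ 4) (q ^ 5) (Suc n) * qpoch q (q ^ 5) (Suc n)"
      unfolding Suc.IH qpoch_Suc z by (simp only: mult_ac)
    finally show ?case .
  qed simp
  have q5: "norm (q ^ 5) < 1"
    using assms by (simp add: norm_power power_less_one_iff)
  have sub: "filterlim (\<lambda>n::nat. 5 * n) sequentially sequentially"
    by (rule filterlim_at_top_mono[OF filterlim_ident]) simp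
  have "(\<lambda>n. \<Prod>m<Suc n. ?w m) \<longlonglongrightarrow> (\<Prod>m. ?w m)"
    unfolding lessThan_Suc_atMost by (intro convergent_prod_LIMSEQ convergent_prod_residues assms)
  then have "(\<lambda>n. \<Prod>m<n. ?w m) \<longlonglongrightarrow> (\<Prod>m. ?w m)"
    by (subst (asm) filterlim_sequentially_Suc)
  then have "(\<lambda>n. qpoch q q (5 * n) * (\<Prod>m<5 * n. ?w m)) \<longlonglongrightarrow> qpoch_inf q q * (\<Prod>m. ?w m)"
    by (intro tendsto_mult filterlim_compose[OF qpoch_tendsto[OF assms] sub] filterlim_compose[OF _ sub])
  moreover have "(\<lambda>n. qpoch q q (5 * n) * (\<Prod>m<5 * n. ?w m)) \<longlonglongrightarrow>
      qpoch_inf (q ^ 5) (q ^ 5) * qpoch_inf (q ^ 4) (q ^ 5) * qpoch_inf q (q ^ 5)"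
    unfolding finite by (intro tendsto_mult qpoch_tendsto q5)
  ultimately have "qpoch_inf q q * (\<Prod>m. ?w m) =
      qpoch_inf (q ^ 5) (q ^ 5) * qpoch_inf (q ^ 4) (q ^ 5) * qpoch_inf q (q ^ 5)"
    by (rule LIMSEQ_unique)
  then show ?thesis
    using qpoch_inf_nonzero[OF assms] by (simp add: field_simps)
qed

theorem rogers_ramanujan_second:
  assumes "norm q < 1"
  shows "((\<lambda>n. q ^ (n\<^sup>2 + n) / qpoch q q n) has_sum
           (\<Prod>m. if rr_residue m then 1 / (1 - q ^ m) else 1)) UNIV"
  using sum_eq_theta_quotient[OF assms] unfolding theta_quotient_eq_prodinf[OF assms] .

section \<open>Evaluation of the double sum\<close>

lemma qpoch_square_base:
  assumes "norm q < 1"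
  shows "qpoch (q\<^sup>2) q n = qpoch q q (Suc n) / (1 - q)"
    and "qpoch_inf (q\<^sup>2) q = qpoch_inf q q / (1 - q)"
proof -
  have "1 - q \<noteq> 0"
    using assms by auto
  then have *: "qpoch (q\<^sup>2) q n = qpoch q q (Suc n) / (1 - q)" for n
    by (simp add: qpoch_Suc_shift power2_eq_square)
  then show "qpoch (q\<^sup>2) q n = qpoch q q (Suc n) / (1 - q)" .
  have "qpoch (q\<^sup>2) q \<longlonglongrightarrow> qpoch_inf q q / (1 - q)"
    unfolding * using \<open>1 - q \<noteq> 0\<close> by (intro tendsto_divide LIMSEQ_Suc[OF qpoch_tendsto] tendsto_const assms)
  then show "qpoch_inf (q\<^sup>2) q = qpoch_inf q q / (1 - q)"
    using qpoch_tendsto[OF assms] by (rule LIMSEQ_unique[rotated])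
qed

theorem mainTheorem12:
  fixes q :: complex
  assumes "norm q < 1"
  shows "((\<lambda>(n, l). q ^ (n\<^sup>2 + l\<^sup>2 + n + l + n * l) /
             (qpoch (q\<^sup>2) q (n + l) * qpoch q q n * qpoch q q l))
          has_sum
          (1 / qpoch_inf (q\<^sup>2) q *
            (\<Prod>m. if m \<ge> 1 \<and> \<not> [int m = 0] (mod 5) \<and> \<not> [int m = 1] (mod 5) \<and> \<not> [int m = - 1] (mod 5)
                  then 1 / (1 - q ^ m) else 1)))
         (UNIV :: (nat \<times> nat) set)"
proof -
  define f where "f = (\<lambda>(n, l). q ^ (n\<^sup>2 + l\<^sup>2 + n + l + n * l) /
             (qpoch (q\<^sup>2) q (n + l) * qpoch q q n * qpoch q q l))"
  obtain C where C: "C > 0" "\<And>n. norm (1 / qpoch q q n) \<le> C"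
    using qpoch_bounds[OF assms] by metis
  have f: "f (n, l) = (1 - q) * (q ^ (n\<^sup>2 + l\<^sup>2 + n + l + n * l) *
      (1 / qpoch q q (Suc (n + l)) * (1 / qpoch q q n) * (1 / qpoch q q l)))" for n l
    by (simp add: f_def qpoch_square_base[OF assms])
  have "(f has_sum (1 / qpoch_inf (q\<^sup>2) q * (\<Prod>m. if rr_residue m then 1 / (1 - q ^ m) else 1))) (UNIV \<times> UNIV)"
  proof (rule has_sum_SigmaI)
    show "((\<lambda>l. f (n, l)) has_sum 1 / qpoch_inf (q\<^sup>2) q * (q ^ (n\<^sup>2 + n) / qpoch q q n)) UNIV" for n
    proof -
      have "f (n, l) = (1 - q) * (q ^ (n\<^sup>2 + n) / qpoch q q n) *
          (q ^ (l * (l + Suc n)) / (qpoch q q l * qpoch q q (l + Suc n)))" for l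
      proof -
        \<comment> \<open>Collecting the terms with l exposes the Durfee summand with a = n +
          1.\<close>
        have "n\<^sup>2 + l\<^sup>2 + n + l + n * l = n\<^sup>2 + n + l * (l + Suc n)" "l + Suc n = Suc (n + l)"
          by (simp_all add: power2_eq_square algebra_simps)
        then have "q ^ (n\<^sup>2 + l\<^sup>2 + n + l + n * l) = q ^ (n\<^sup>2 + n) * q ^ (l * (l + Suc n))"
          by (simp only: power_add)
        then show ?thesis
          unfolding f \<open>l + Suc n = Suc (n + l)\<close> by (simp add: mult_ac)
      qed
      then have "((\<lambda>l. f (n, l)) has_sum (1 - q) * (q ^ (n\<^sup>2 + n) / qpoch q q n) * (1 / qpoch_inf q q)) UNIV"
        by (simp only:) (intro has_sum_cmult_right durfee_rectangle assms)
      then show ?thesis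
        by (simp add: qpoch_square_base[OF assms] mult_ac)
    qed
    show "((\<lambda>n. 1 / qpoch_inf (q\<^sup>2) q * (q ^ (n\<^sup>2 + n) / qpoch q q n)) has_sum
        1 / qpoch_inf (q\<^sup>2) q * (\<Prod>m. if rr_residue m then 1 / (1 - q ^ m) else 1)) UNIV"
      by (intro has_sum_cmult_right rogers_ramanujan_second assms)
    show "f summable_on UNIV \<times> UNIV"
    proof (rule summable_on_double_geometric)
      fix n l
      have "norm (1 - q) \<le> 2"
        using norm_triangle_ineq4[of 1 q] assms by simp
      \<comment> \<open>The exponent of q is at least n + l, and each of the three reciprocals is
        bounded by C.\<close>
      then have "norm (f (n, l)) \<le> 2 * (norm q ^ (n + l) * (C * C * C))"
        unfolding f norm_mult norm_power using C assms
        by (intro mult_mono power_decreasing mult_nonneg_nonneg) (auto intro: less_imp_le)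
      then show "norm (f (n, l)) \<le> (2 * (C * C * C)) * (norm q ^ n * norm q ^ l)"
        by (simp add: power_add mult_ac)
    qed (use assms C in auto)
  qed
  then show ?thesis
    unfolding f_def rr_residue_def by simp
qed

end
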